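(* Let $\mathbf{A}\in\mathbb{R}^{n\times n}$ be symmetric with eigenvalues $\lambda_1\le\cdots\le\lambda_n$ and corresponding orthonormal eigenvectors $\mathbf{v}_1,\dots,\mathbf{v}_n$, let $\mathbf{b}\in\mathbb{R}^n$ with $\mathbf{b}^{\mathrm T}\mathbf{v}_1\neq 0$, let $\rho>0$, let $1\le m<n$, put $c_i=-\mathbf{b}^{\mathrm T}\mathbf{v}_i$, and assume $\sum_{i=m+1}^n c_i^2\ne0$. With $$\mu=\frac{\sum_{i=m+1}^n c_i^2\lambda_i}{\sum_{i=m+1}^n c_i^2},$$ the function $$w_2(\sigma;\mu)=\sum_{i=1}^m\frac{c_i^2}{(\lambda_i+\sigma)^2}+\sum_{i=m+1}^n\frac{c_i^2}{(\mu+\sigma)^2}-2\sum_{i=m+1}^n\frac{c_i^2(\lambda_i-\mu)}{(\mu+\sigma)^3}-\frac{\sigma^2}{\rho^2}$$ admits a unique root $\sigma$ in $(\max\{-\lambda_1,0\},+\infty)$. *)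

theory Defs
  imports "HOL-Analysis.Analysis"
begin

text \<open>
  The function \<open>w\<^sub>2(\<sigma>; \<mu>)\<close> for data \<open>\<lambda>\<^sub>1, \<dots>, \<lambda>\<^sub>n\<close> and \<open>c\<^sub>1, \<dots>, c\<^sub>n\<close>, indexed from 1 to \<open>n\<close>.
  The third sum vanishes for the weighted mean \<open>\<mu>\<close> of the trailing eigenvalues, but \<open>\<mu>\<close> is a free
  parameter here.
\<close>

definition w2 ::
  "nat \<Rightarrow> nat \<Rightarrow> (nat \<Rightarrow> real) \<Rightarrow> (nat \<Rightarrow> real) \<Rightarrow> real \<Rightarrow> real \<Rightarrow> real \<Rightarrow> real"
where
  "w2 n m lam c \<rho> \<mu> \<sigma> =
     (\<Sum>i=1..m. (c i)\<^sup>2 / (lam i + \<sigma>)\<^sup>2)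
     + (\<Sum>i=m+1..n. (c i)\<^sup>2 / (\<mu> + \<sigma>)\<^sup>2)
     - 2 * (\<Sum>i=m+1..n. (c i)\<^sup>2 * (lam i - \<mu>) / (\<mu> + \<sigma>) ^ 3)
     - \<sigma>\<^sup>2 / \<rho>\<^sup>2"

end

theory Submission
  imports Defs
begin

text \<open>
  The numerator of the third sum of \<open>w\<^sub>2\<close> vanishes because \<open>\<mu>\<close> is the weighted mean of the trailing
  eigenvalues. Hence \<open>w\<^sub>2\<close> is the difference of a secular function
  \<open>\<Sum> a\<^sub>i / (d\<^sub>i + \<sigma>)\<^sup>2\<close>, whose rightmost pole is \<open>-\<lambda>\<^sub>1\<close> because \<open>\<mu> \<ge> \<lambda>\<^sub>1\<close>, and of \<open>\<sigma>\<^sup>2 / \<rho>\<^sup>2\<close>.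
  On the interval the former decreases and the latter strictly increases, which gives uniqueness;
  existence is the intermediate value theorem.
\<close>

text \<open>Just right of \<open>max (- d k) 0\<close> either the \<open>k\<close>-th term blows up
  or \<open>x\<close> is close to 0, so that term alone exceeds the quadratic. The
  \<open>d i\<close> may coincide, which lets several trailing terms share the pole at
  \<open>- \<mu>\<close>.\<close>

lemma secular_equation_unique_root:
  fixes a d :: "'i \<Rightarrow> real" and r :: real
  assumes fin: "finite I" and k: "k \<in> I" and ak: "a k > 0"
    and nonneg: "\<And>i. i \<in> I \<Longrightarrow> a i \<ge> 0"
    and least: "\<And>i. i \<in> I \<Longrightarrow> d k \<le> d i"
    and r: "r > 0"
  shows "\<exists>!x. x > max (- d k) 0 \<and> (\<Sum>i\<in>I. a i / (d i + x)\<^sup>2) - x\<^sup>2 / r\<^sup>2 = 0"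
proof -
  define s where "s = max (- d k) 0"
  define f where "f x = (\<Sum>i\<in>I. a i / (d i + x)\<^sup>2) - x\<^sup>2 / r\<^sup>2" for x
  have pos: "d i + x > 0" if "i \<in> I" "x > s" for i x
    using least[OF that(1)] that(2) unfolding s_def by linarith
  have strict: "f y < f x" if "s < x" "x < y" for x y
  proof -
    have "(\<Sum>i\<in>I. a i / (d i + y)\<^sup>2) \<le> (\<Sum>i\<in>I. a i / (d i + x)\<^sup>2)"
    proof (rule sum_mono)
      fix i assume i: "i \<in> I"
      have "0 < d i + x" using pos i that by blast
      then show "a i / (d i + y)\<^sup>2 \<le> a i / (d i + x)\<^sup>2"
        using nonneg[OF i] that by (intro divide_left_mono power_mono) auto
    qed
    moreover have "x\<^sup>2 / r\<^sup>2 < y\<^sup>2 / r\<^sup>2"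
      using that r by (intro divide_strict_right_mono power_strict_mono) (auto simp: s_def)
    ultimately show ?thesis unfolding f_def by linarith
  qed
  \<comment> \<open>At distance \<open>t\<close> to the right of \<open>s\<close> the product \<open>x (d\<^sub>k + x)\<close> equals \<open>t (\<bar>d\<^sub>k\<bar> + t)\<close>, and the
    \<open>k\<close>-th term alone outweighs \<open>x\<^sup>2 / r\<^sup>2\<close> as soon as this product is below \<open>r \<surd>a\<^sub>k\<close>.\<close>
  define t where "t = min 1 (r * sqrt (a k) / (2 * (\<bar>d k\<bar> + 1)))"
  have t: "0 < t" "t \<le> 1" using r ak by (auto simp: t_def)
  define p where "p = s + t"
  have p: "p > s" "p > 0" using t by (auto simp: p_def s_def)
  have "p * (d k + p) = t * (\<bar>d k\<bar> + t)"
    \<comment> \<open>If \<open>d k < 0\<close>, then \<open>d k + p = t\<close> and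
      \<open>p = \<bar>d k\<bar> + t\<close>; otherwise the two factors swap values.\<close>
    by (auto simp: p_def s_def max_def algebra_simps)
  also have "\<dots> \<le> t * (\<bar>d k\<bar> + 1)" using t by simp
  also have "\<dots> \<le> (r * sqrt (a k) / (2 * (\<bar>d k\<bar> + 1))) * (\<bar>d k\<bar> + 1)"
    by (intro mult_right_mono) (auto simp: t_def)
  also have "\<dots> = r * sqrt (a k) / 2" by (simp add: divide_simps)
  also have "\<dots> < r * sqrt (a k)" using r ak by simp
  finally have "p * (d k + p) < r * sqrt (a k)" .
  then have "p / r < sqrt (a k) / (d k + p)"
    using pos[OF k p(1)] r by (simp add: field_simps)
  then have "(p / r)\<^sup>2 < (sqrt (a k) / (d k + p))\<^sup>2"
    using p r by (intro power_strict_mono) auto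
  then have "p\<^sup>2 / r\<^sup>2 < a k / (d k + p)\<^sup>2"
    using ak by (simp add: power_divide)
  also have "\<dots> \<le> (\<Sum>i\<in>I. a i / (d i + p)\<^sup>2)"
    using nonneg by (intro member_le_sum[OF k] fin) auto
  finally have fp: "f p > 0" by (simp add: f_def)

  define C where "C = (\<Sum>i\<in>I. a i)"
  have C: "C \<ge> 0" unfolding C_def by (intro sum_nonneg nonneg)
  \<comment> \<open>The part \<open>s + 1\<close> makes every denominator at least 1, bounding the
    sum by \<open>C\<close>; the part \<open>r * (1 + C)\<close> gives
    \<open>q / r \<ge> 1 + C\<close>.\<close>
  define q where "q = s + 1 + r * (1 + C)"
  have q: "q \<ge> s + 1" using r C by (simp add: q_def)
  have "(\<Sum>i\<in>I. a i / (d i + q)\<^sup>2) \<le> C"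
    unfolding C_def
  proof (rule sum_mono)
    fix i assume i: "i \<in> I"
    have "1 \<le> d i + q" using least[OF i] q by (auto simp: s_def)
    then have "1 \<le> (d i + q)\<^sup>2" "d i + q \<noteq> 0" by simp_all
    then show "a i / (d i + q)\<^sup>2 \<le> a i"
      using divide_left_mono[of 1 "(d i + q)\<^sup>2" "a i"] nonneg[OF i] by simp
  qed
  also have "C < (1 + C)\<^sup>2" using C by (simp add: power2_sum add_nonneg_pos add_pos_nonneg)
  also have "\<dots> \<le> (q / r)\<^sup>2"
  proof (rule power_mono)
    have "(1 + C) * r \<le> q" by (simp add: q_def s_def algebra_simps)
    then show "1 + C \<le> q / r" using r by (simp add: le_divide_eq)
  qed (use C in simp)
  finally have fq: "f q < 0" by (simp add: f_def power_divide)

  have "\<forall>x. p \<le> x \<and> x \<le> q \<longrightarrow> isCont f x"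
  proof (intro allI impI)
    fix x assume "p \<le> x \<and> x \<le> q"
    then have "d i + x \<noteq> 0" if "i \<in> I" for i using pos[OF that, of x] p by linarith
    then show "isCont f x" unfolding f_def using r by (intro continuous_intros) auto
  qed
  moreover have "p \<le> q" using t q by (simp add: p_def)
  ultimately obtain x where x: "p \<le> x" "f x = 0"
    using IVT2[of f q 0 p] fp fq by auto
  show ?thesis
    unfolding s_def[symmetric] f_def[symmetric]
  proof (rule ex1I[of _ x])
    show "s < x \<and> f x = 0" using x p by simp
    show "y = x" if "s < y \<and> f y = 0" for y
      using strict[of x y] strict[of y x] that x p by (cases x y rule: linorder_cases) auto
  qed
qed

theorem lemma2:
  fixes A :: "real ^ 'n ^ 'n"
    and b :: "real ^ 'n"
    and v :: "nat \<Rightarrow> real ^ 'n"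
    and lam c :: "nat \<Rightarrow> real"
    and \<rho> \<mu> :: real
    and n m :: nat
  assumes n: "n = CARD('n)"
    and symmetric: "transpose A = A"
    and eigen: "\<forall>i\<in>{1..n}. A *v v i = lam i *\<^sub>R v i"
    and orthonormal: "\<forall>i\<in>{1..n}. \<forall>j\<in>{1..n}. v i \<bullet> v j = (if i = j then 1 else 0)"
    and ordered: "\<forall>i\<in>{1..n}. \<forall>j\<in>{1..n}. i \<le> j \<longrightarrow> lam i \<le> lam j"
    and b: "b \<bullet> v 1 \<noteq> 0"
    and rho: "\<rho> > 0"
    and m: "1 \<le> m" "m < n"
    and c: "\<forall>i\<in>{1..n}. c i = - (b \<bullet> v i)"
    and nonzero: "(\<Sum>i=m+1..n. (c i)\<^sup>2) \<noteq> 0"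
    and mu: "\<mu> = (\<Sum>i=m+1..n. (c i)\<^sup>2 * lam i) / (\<Sum>i=m+1..n. (c i)\<^sup>2)"
  shows "\<exists>!\<sigma>. \<sigma> \<in> {max (- lam 1) 0 <..} \<and> w2 n m lam c \<rho> \<mu> \<sigma> = 0"
proof -
  define S where "S = (\<Sum>i=m+1..n. (c i)\<^sup>2)"
  have S: "S > 0" using nonzero sum_nonneg[of "{m+1..n}" "\<lambda>i. (c i)\<^sup>2"] by (simp add: S_def)
  have mean: "(\<Sum>i=m+1..n. (c i)\<^sup>2 * lam i) = \<mu> * S"
    using mu S by (simp add: S_def)
  have "S * lam 1 \<le> (\<Sum>i=m+1..n. (c i)\<^sup>2 * lam i)"
    unfolding S_def sum_distrib_right
    using ordered m by (intro sum_mono) (auto intro!: mult_left_mono)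
  then have mu_ge: "lam 1 \<le> \<mu>" using mean S by simp
  \<comment> \<open>Moving the trailing poles to \<open>- \<mu>\<close> merges the first two sums of
    \<open>w2\<close> into one secular sum.\<close>
  define d where "d i = (if i \<le> m then lam i else \<mu>)" for i
  have d1: "d 1 = lam 1" using m by (simp add: d_def)
  \<comment> \<open>This holds for every \<open>x\<close>, even at poles since division by 0 gives
    0, so it can rewrite under the quantifier at the end.\<close>
  have w2: "w2 n m lam c \<rho> \<mu> x = (\<Sum>i=1..n. (c i)\<^sup>2 / (d i + x)\<^sup>2) - x\<^sup>2 / \<rho>\<^sup>2" for x
  proof -
    have "(\<Sum>i=m+1..n. (c i)\<^sup>2 * (lam i - \<mu>)) = 0"
      using mean by (simp add: right_diff_distrib sum_subtractf S_def
          flip: sum_distrib_right)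
    then have third: "(\<Sum>i=m+1..n. (c i)\<^sup>2 * (lam i - \<mu>) / (\<mu> + x) ^ 3) = 0"
      by (simp add: sum_divide_distrib[symmetric])
    have "{1..n} = {1..m} \<union> {m+1..n}" using m by auto
    then have "(\<Sum>i=1..n. (c i)\<^sup>2 / (d i + x)\<^sup>2)
        = (\<Sum>i=1..m. (c i)\<^sup>2 / (d i + x)\<^sup>2) + (\<Sum>i=m+1..n. (c i)\<^sup>2 / (d i + x)\<^sup>2)"
      by (simp add: sum.union_disjoint)
    also have "\<dots> = (\<Sum>i=1..m. (c i)\<^sup>2 / (lam i + x)\<^sup>2) + (\<Sum>i=m+1..n. (c i)\<^sup>2 / (\<mu> + x)\<^sup>2)"
      by (simp add: d_def)
    finally show ?thesis using third by (simp add: w2_def)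
  qed
  have "\<exists>!x. x > max (- d 1) 0 \<and> (\<Sum>i=1..n. (c i)\<^sup>2 / (d i + x)\<^sup>2) - x\<^sup>2 / \<rho>\<^sup>2 = 0"
  proof (rule secular_equation_unique_root)
    \<comment> \<open>Here \<open>b \<bullet> v 1 \<noteq> 0\<close> makes the term with the least
      \<open>d i\<close> present.\<close>
    show "(c 1)\<^sup>2 > 0" using b c m by simp
    show "d 1 \<le> d i" if "i \<in> {1..n}" for i
      using ordered mu_ge that m d1 by (simp add: d_def)
  qed (use m rho in auto)
  then show ?thesis by (simp only: w2 d1 greaterThan_iff)
qed

end
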